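(* Let $\sigma,\tau,\upsilon\in(-\pi,\pi]$ and $\phi,\psi,\chi\in(-\tfrac12\pi,\tfrac12\pi)$. Suppose that $\mathbf z[\sigma,\phi]$, $\mathbf z[\tau,\psi]$, $\mathbf z[\upsilon,\chi]$ are three points of $\mathbb{CP}^2$ that are a distance $2\pi/3$ away from each other and from the two points $[0,1,-\omega]$ and $[0,1,-\omega^2]$, where $\omega=e^{2\pi i/3}$. Set $x=\tan\phi$, $y=\tan\psi$, $z=\tan\chi$ and $$p=x+y+z,\qquad q=yz+zx+xy,\qquad r=xyz.$$ Then $F(p,q,r)=0$, where $$\begin{aligned} F(p,q,r)={}& 9 - 22 p^2 + 9 p^4 + 87 q - 126 p^2 q + 27 p^4 q + 298 q^2 - 226 p^2q^2\\ &+ 24 p^4 q^2+ 414 q^3 - 138 p^2 q^3 + 189 q^4 + 27 q^5 - 3 p r - 50 p^3 r - 15 p^5 r\\ &+ 88 p q r- 48 p^3 q r + 234 p q^2 r + 18 p^3 q^2 r - 144 p q^3 r + 81 p q^4 r + 189 r^2\\ &- 480 p^2 r^2 - 153 p^4 r^2 + 1398 q r^2 - 306 p^2 q r^2 + 2736 q^2 r^2- 486 p^2 q^2 r^2\\ &+ 810 q^3 r^2 + 243 q^4 r^2 - 558 p r^3 - 486 p^3 r^3 + 2376 p q r^3 - 810 p q^2 r^3\\ &+ 567 r^4 - 162 p^2 r^4 + 6399 q r^4 + 486 q^2 r^4 + 1701 p r^5 + 2187 r^6. \end{aligned}$$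
   Context: For $\mathbf z\in\mathbb C^3\setminus\{0\}$, $[\mathbf z]=[z_1,z_2,z_3]$ denotes the corresponding point of $\mathbb{CP}^2$, and $\langle\mathbf w,\mathbf z\rangle=\sum_i\overline{w_i}z_i$. The distance on $\mathbb{CP}^2$ is $d([\mathbf w],[\mathbf z])=2\arccos\big(|\langle\mathbf w,\mathbf z\rangle|/(\|\mathbf w\|\|\mathbf z\|)\big)\in[0,\pi]$; thus two points are a distance $2\pi/3$ apart exactly when $|\langle\mathbf w,\mathbf z\rangle|^2=\tfrac14\|\mathbf w\|^2\|\mathbf z\|^2$. For real $\sigma,\phi$, $\mathbf z[\sigma,\phi]\in\mathbb{CP}^2$ denotes the point $$\mathbf z[\sigma,\phi]=\big[e^{i\sigma}\cos\phi,\ \cos(\phi+\tfrac23\pi),\ \cos(\phi+\tfrac43\pi)\big].$$ *)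

theory Defs
  imports "HOL-Analysis.Analysis"
begin

definition hform :: "complex ^ 3 \<Rightarrow> complex ^ 3 \<Rightarrow> complex"
  where "hform w z = (\<Sum>i\<in>UNIV. cnj (w $ i) * z $ i)"

definition proportional :: "complex ^ 3 \<Rightarrow> complex ^ 3 \<Rightarrow> bool"
  where "proportional w z \<longleftrightarrow> w \<noteq> 0 \<and> z \<noteq> 0 \<and> (\<exists>c. z = c *s w)"

lemma proportional_scalar:
  assumes "proportional w z"
  obtains c where "c \<noteq> 0" "z = c *s w"
  using assms unfolding proportional_def by auto

lemma part_equivp_proportional: "part_equivp proportional"
proof (rule part_equivpI)
  have "proportional (axis 1 1) (axis 1 1)"
    unfolding proportional_def by (auto simp: axis_eq_0_iff intro: exI [of _ 1])
  then show "\<exists>x. proportional x x" by blast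
  show "symp proportional"
  proof (rule sympI)
    fix w z assume wz: "proportional w z"
    then obtain c where "c \<noteq> 0" "z = c *s w"
      by (rule proportional_scalar)
    then have "w = inverse c *s z"
      by (simp add: vector_smult_assoc)
    with wz show "proportional z w"
      unfolding proportional_def by blast
  qed
  show "transp proportional"
    by (rule transpI) (auto simp: proportional_def vector_smult_assoc)
qed

text \<open>The complex projective plane. The relation is partial, so only nonzero vectors
  represent points (proportionality of nonzero vectors forces a nonzero factor); the point \<open>proj z\<close> is meaningful for \<open>z \<noteq> 0\<close> only.\<close>

quotient_type cp2 = "complex ^ 3" / partial: proportional
  morphisms cp2_rep proj
  by (rule part_equivp_proportional)

lemma proj_eq_iff:
  assumes "w \<noteq> 0" and "z \<noteq> 0"
  shows "proj w = proj z \<longleftrightarrow> (\<exists>c. z = c *s w)"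
proof -
  have refl: "proportional x x" if "x \<noteq> 0" for x
    using that unfolding proportional_def by (auto intro: exI [of _ 1])
  show ?thesis
    using Quotient3_rel [OF Quotient3_cp2, of w z] refl assms
    by (auto simp: proportional_def)
qed

lemma norm_smult_vec: "norm (c *s w) = cmod c * norm (w :: complex ^ 3)"
proof -
  have "norm (c *s w) = L2_set (\<lambda>i. cmod c * cmod (w $ i)) UNIV"
    by (simp add: norm_vec_def norm_mult)
  also have "\<dots> = cmod c * norm w"
    by (simp add: norm_vec_def L2_set_right_distrib)
  finally show ?thesis .
qed

lemma hform_smult: "hform (a *s w) (b *s z) = cnj a * b * hform w z"
  unfolding hform_def by (simp add: sum_distrib_left mult_ac)

text \<open>The library norm on \<open>complex ^ 3\<close> is the Hermitian one,
  \<open>(norm z)\<^sup>2 = hform z z\<close>.\<close>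

lift_definition cp2_dist :: "cp2 \<Rightarrow> cp2 \<Rightarrow> real"
  is "\<lambda>w z. 2 * arccos (cmod (hform w z) / (norm w * norm z))"
proof -
  fix w w' z z' assume "proportional w w'" "proportional z z'"
  then obtain a b where "a \<noteq> 0" "w' = a *s w" "b \<noteq> 0" "z' = b *s z"
    by (metis proportional_scalar)
  then have "cmod (hform w' z') / (norm w' * norm z') = cmod (hform w z) / (norm w * norm z)"
    by (simp add: hform_smult norm_smult_vec norm_mult)
  then show "2 * arccos (cmod (hform w z) / (norm w * norm z)) =
      2 * arccos (cmod (hform w' z') / (norm w' * norm z'))"
    by simp
qed

lemma cp2_dist_proj:
  assumes "w \<noteq> 0" and "z \<noteq> 0"
  shows "cp2_dist (proj w) (proj z) = 2 * arccos (cmod (hform w z) / (norm w * norm z))"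
  using assms by (intro cp2_dist.abs_eq)
    (auto simp: proportional_def eq_onp_def intro: exI [of _ 1])

definition zvec :: "real \<Rightarrow> real \<Rightarrow> complex ^ 3"
  where "zvec \<sigma> \<phi> = vector [exp (\<i> * of_real \<sigma>) * of_real (cos \<phi>),
    of_real (cos (\<phi> + 2 / 3 * pi)), of_real (cos (\<phi> + 4 / 3 * pi))]"

lemma zvec_nonzero: "zvec \<sigma> \<phi> \<noteq> 0"
proof
  assume *: "zvec \<sigma> \<phi> = 0"
  have "zvec \<sigma> \<phi> $ 1 = 0" "zvec \<sigma> \<phi> $ 2 = 0"
    using * by simp_all
  then have "cos \<phi> = 0" "cos (\<phi> + 2 / 3 * pi) = 0"
    by (simp_all only: zvec_def vector_3 mult_eq_0_iff exp_not_eq_zero of_real_eq_0_iff simp_thms)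
  moreover have "sin (2 / 3 * pi) \<noteq> 0"
    using sin_gt_zero [of "2 / 3 * pi"] by auto
  ultimately show False
    using sin_zero_norm_cos_one [of \<phi>] sin_cos_squared_add [of \<phi>]
    by (auto simp: cos_add)
qed

definition zpt :: "real \<Rightarrow> real \<Rightarrow> cp2"
  where "zpt \<sigma> \<phi> = proj (zvec \<sigma> \<phi>)"

definition omega :: complex
  where "omega = exp (2 * of_real pi * \<i> / 3)"

definition F :: "real \<Rightarrow> real \<Rightarrow> real \<Rightarrow> real" where
  "F p q r =
     9 - 22*p^2 + 9*p^4 + 87*q - 126*p^2*q + 27*p^4*q + 298*q^2 - 226*p^2*q^2
     + 24*p^4*q^2 + 414*q^3 - 138*p^2*q^3 + 189*q^4 + 27*q^5 - 3*p*r - 50*p^3*r - 15*p^5*r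
     + 88*p*q*r - 48*p^3*q*r + 234*p*q^2*r + 18*p^3*q^2*r - 144*p*q^3*r + 81*p*q^4*r + 189*r^2
     - 480*p^2*r^2 - 153*p^4*r^2 + 1398*q*r^2 - 306*p^2*q*r^2 + 2736*q^2*r^2 - 486*p^2*q^2*r^2
     + 810*q^3*r^2 + 243*q^4*r^2 - 558*p*r^3 - 486*p^3*r^3 + 2376*p*q*r^3 - 810*p*q^2*r^3
     + 567*r^4 - 162*p^2*r^4 + 6399*q*r^4 + 486*q^2*r^4 + 1701*p*r^5 + 2187*r^6"

end

theory Submission
  imports Defs
begin

text \<open>Pairwise distance \<open>2 * pi / 3\<close> fixes the cosine of each phase difference,
  \<open>16 * (1 + 3 * x * y) * cos (\<tau> - \<sigma>) = 9 * (1 + x\<^sup>2) * (1 + y\<^sup>2) - 16 - 4 * (1 + 3 * x * y)\<^sup>2\<close>, and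
  cyclically. The three phase differences sum to zero, so their cosines satisfy
  \<open>1 - a\<^sup>2 - b\<^sup>2 - c\<^sup>2 + 2 * a * b * c = 0\<close>. Clearing the factors \<open>1 + 3 * x * y\<close> turns this into
  \<open>-243 * F p q r = 0\<close>. No factor is ever divided out, so vanishing factors cause no trouble.\<close>

text \<open>Cauchy-Schwarz. It keeps the argument of \<open>arccos\<close> in the distance within
  [0, 1], where \<open>cos\<close> undoes \<open>arccos\<close>.\<close>

lemma cmod_hform_le: "cmod (hform w z) \<le> norm w * norm z"
proof -
  have "cmod (hform w z) \<le> (\<Sum>i\<in>UNIV. cmod (w $ i) * cmod (z $ i))"
    unfolding hform_def by (intro sum_norm_le) (simp add: norm_mult)
  also have "\<dots> \<le> norm w * norm z"
    unfolding norm_vec_def using L2_set_mult_ineq [of "\<lambda>i. cmod (w $ i)" "\<lambda>i. cmod (z $ i)" UNIV]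
    by simp
  finally show ?thesis .
qed

lemma cp2_dist_proj_eq_iff:
  assumes "w \<noteq> 0" "z \<noteq> 0"
  shows "cp2_dist (proj w) (proj z) = 2 * pi / 3 \<longleftrightarrow> 2 * cmod (hform w z) = norm w * norm z"
proof -
  define t where "t = cmod (hform w z) / (norm w * norm z)"
  have pos: "norm w * norm z > 0"
    using assms by simp
  have t: "0 \<le> t" "t \<le> 1"
    using pos cmod_hform_le [of w z] by (auto simp: t_def divide_le_eq)
  have "arccos t = pi / 3 \<longleftrightarrow> t = 1 / 2"
  proof
    assume "arccos t = pi / 3"
    then have "cos (arccos t) = 1 / 2"
      by (simp only: cos_60)
    then show "t = 1 / 2"
      using t by simp
  next
    assume "t = 1 / 2"
    then show "arccos t = pi / 3"
      using arccos_cos [of "pi / 3"] by (simp only: cos_60) simp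
  qed
  moreover have "t = 1 / 2 \<longleftrightarrow> 2 * cmod (hform w z) = norm w * norm z"
    using pos by (auto simp: t_def field_simps)
  moreover have "cp2_dist (proj w) (proj z) = 2 * pi / 3 \<longleftrightarrow> arccos t = pi / 3"
    unfolding cp2_dist_proj [OF assms] t_def [symmetric] by auto
  ultimately show ?thesis
    by simp
qed

lemma sin_cos_pi_thirds:
  "cos (2 / 3 * pi) = - 1 / 2" "sin (2 / 3 * pi) = sqrt 3 / 2"
  "cos (4 / 3 * pi) = - 1 / 2" "sin (4 / 3 * pi) = - sqrt 3 / 2"
proof -
  have eqs: "2 / 3 * pi = pi - pi / 3" "4 / 3 * pi = pi + pi / 3"
    by simp_all
  show "cos (2 / 3 * pi) = - 1 / 2" "sin (2 / 3 * pi) = sqrt 3 / 2"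
    "cos (4 / 3 * pi) = - 1 / 2" "sin (4 / 3 * pi) = - sqrt 3 / 2"
    unfolding eqs by (simp_all only: cos_add sin_add cos_diff sin_diff, simp_all add: cos_60 sin_60)
qed

text \<open>The two shifts have equal cosines and opposite sines, so the mixed sine-cosine terms
  cancel.\<close>

lemma cos_shift_prod_sum:
  "cos (\<phi> + 2 / 3 * pi) * cos (\<psi> + 2 / 3 * pi) + cos (\<phi> + 4 / 3 * pi) * cos (\<psi> + 4 / 3 * pi)
    = (cos \<phi> * cos \<psi> + 3 * sin \<phi> * sin \<psi>) / 2"
proof -
  have "sqrt 3 * (sqrt 3 * a) = 3 * a" for a :: real
    by (simp flip: mult.assoc)
  then show ?thesis
    unfolding cos_add sin_cos_pi_thirds by (simp add: field_simps)
qed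

text \<open>Only the first coordinate carries a phase, so the phases enter through their difference
  alone.\<close>

lemma hform_zvec:
  "hform (zvec \<sigma> \<phi>) (zvec \<tau> \<psi>) =
    cis (\<tau> - \<sigma>) * of_real (cos \<phi> * cos \<psi>) + of_real ((cos \<phi> * cos \<psi> + 3 * sin \<phi> * sin \<psi>) / 2)"
proof -
  have "hform (zvec \<sigma> \<phi>) (zvec \<tau> \<psi>) = cnj (cis \<sigma>) * cis \<tau> * of_real (cos \<phi> * cos \<psi>) +
      of_real (cos (\<phi> + 2 / 3 * pi) * cos (\<psi> + 2 / 3 * pi)
        + cos (\<phi> + 4 / 3 * pi) * cos (\<psi> + 4 / 3 * pi))"
    unfolding hform_def zvec_def sum_3 vector_3 cis_conv_exp [symmetric] by simp
  also have "cnj (cis \<sigma>) * cis \<tau> = cis (\<tau> - \<sigma>)"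
    by (simp add: cis_cnj cis_mult)
  finally show ?thesis
    by (simp only: cos_shift_prod_sum)
qed

text \<open>The law of cosines for plane vectors of signed lengths \<open>a\<close> and
  \<open>b\<close>.\<close>

lemma cmod_cis_mult_add_sq:
  "(cmod (cis \<theta> * of_real a + of_real b))\<^sup>2 = a\<^sup>2 + b\<^sup>2 + 2 * a * b * cos \<theta>"
proof -
  have "(cmod (cis \<theta> * of_real a + of_real b))\<^sup>2 = (cos \<theta> * a + b)\<^sup>2 + (sin \<theta> * a)\<^sup>2"
    by (simp add: cmod_power2)
  also have "\<dots> = a\<^sup>2 * ((sin \<theta>)\<^sup>2 + (cos \<theta>)\<^sup>2) + b\<^sup>2 + 2 * a * b * cos \<theta>"
    by algebra
  finally show ?thesis
    by simp
qed

text \<open>The diagonal case of \<open>hform_zvec\<close>: the phase drops out, and Pythagoras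
  removes the angle.\<close>

lemma norm_zvec_sq: "(norm (zvec \<sigma> \<phi>))\<^sup>2 = 3 / 2"
proof -
  have "complex_of_real ((norm (zvec \<sigma> \<phi>))\<^sup>2) = hform (zvec \<sigma> \<phi>) (zvec \<sigma> \<phi>)"
    by (simp add: hform_def norm_vec_def L2_set_def sum_nonneg complex_norm_square mult.commute
        del: of_real_power)
  also have "\<dots> = of_real (cos \<phi> * cos \<phi> + (cos \<phi> * cos \<phi> + 3 * sin \<phi> * sin \<phi>) / 2)"
    unfolding hform_zvec by simp
  also have "cos \<phi> * cos \<phi> + (cos \<phi> * cos \<phi> + 3 * sin \<phi> * sin \<phi>) / 2 =
      3 / 2 * ((sin \<phi>)\<^sup>2 + (cos \<phi>)\<^sup>2)"
    by (simp add: power2_eq_square field_simps del: sin_cos_squared_add3)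
  finally show ?thesis
    by (simp only: of_real_eq_iff sin_cos_squared_add mult_1_right)
qed

lemma cos_phase_difference:
  assumes dist: "cp2_dist (zpt \<sigma> \<phi>) (zpt \<tau> \<psi>) = 2 * pi / 3"
    and "cos \<phi> \<noteq> 0" "cos \<psi> \<noteq> 0"
  defines "x \<equiv> tan \<phi>" and "y \<equiv> tan \<psi>"
  shows "16 * (1 + 3 * x * y) * cos (\<tau> - \<sigma>) =
    9 * (1 + x\<^sup>2) * (1 + y\<^sup>2) - 16 - 4 * (1 + 3 * x * y)\<^sup>2"
proof -
  define a where "a = cos \<phi> * cos \<psi>"
  have sin: "sin \<phi> = x * cos \<phi>" "sin \<psi> = y * cos \<psi>"
    using assms by (simp_all add: tan_def)
  have "2 * cmod (hform (zvec \<sigma> \<phi>) (zvec \<tau> \<psi>)) = norm (zvec \<sigma> \<phi>) * norm (zvec \<tau> \<psi>)"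
    using dist by (simp only: zpt_def cp2_dist_proj_eq_iff [OF zvec_nonzero zvec_nonzero])
  then have "(2 * cmod (hform (zvec \<sigma> \<phi>) (zvec \<tau> \<psi>)))\<^sup>2 = 9 / 4"
    by (simp add: power_mult_distrib norm_zvec_sq)
  moreover have "(cos \<phi> * cos \<psi> + 3 * sin \<phi> * sin \<psi>) / 2 = a * (1 + 3 * x * y) / 2"
    by (simp add: sin a_def algebra_simps)
  ultimately have "4 * (a\<^sup>2 + (a * (1 + 3 * x * y) / 2)\<^sup>2
      + 2 * a * (a * (1 + 3 * x * y) / 2) * cos (\<tau> - \<sigma>)) = 9 / 4"
    by (simp only: hform_zvec power_mult_distrib [of 2] cmod_cis_mult_add_sq a_def [symmetric]) simp
  \<comment> \<open>Pythagoras in terms of tangents. It turns the constant 9 / 4, the product of the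
    squared norms, into a multiple of \<open>a\<^sup>2\<close>, so that this nonzero factor
    cancels.\<close>
  moreover have "a\<^sup>2 * ((1 + x\<^sup>2) * (1 + y\<^sup>2)) = 1"
  proof -
    have "a\<^sup>2 * ((1 + x\<^sup>2) * (1 + y\<^sup>2)) =
        ((sin \<phi>)\<^sup>2 + (cos \<phi>)\<^sup>2) * ((sin \<psi>)\<^sup>2 + (cos \<psi>)\<^sup>2)"
      unfolding sin a_def by algebra
    then show ?thesis by simp
  qed
  ultimately have "a\<^sup>2 * (16 * (1 + 3 * x * y) * cos (\<tau> - \<sigma>)) =
      a\<^sup>2 * (9 * (1 + x\<^sup>2) * (1 + y\<^sup>2) - 16 - 4 * (1 + 3 * x * y)\<^sup>2)"
    by (simp add: power2_eq_square field_simps)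
  then show ?thesis
    using assms by (simp add: a_def)
qed

text \<open>The Gram determinant of three coplanar unit vectors vanishes.\<close>
lemma cos_gram_eq_0:
  fixes \<alpha> \<beta> \<gamma> :: real
  assumes "\<alpha> + \<beta> + \<gamma> = 0"
  shows "1 - (cos \<alpha>)\<^sup>2 - (cos \<beta>)\<^sup>2 - (cos \<gamma>)\<^sup>2 + 2 * cos \<alpha> * cos \<beta> * cos \<gamma> = 0"
proof -
  have "\<gamma> = - (\<alpha> + \<beta>)"
    using assms by simp
  then have "cos \<gamma> = cos \<alpha> * cos \<beta> - sin \<alpha> * sin \<beta>"
    by (simp only: cos_minus cos_add)
  then show ?thesis
    using sin_cos_squared_add [of \<alpha>] sin_cos_squared_add [of \<beta>] by algebra
qed

text \<open>For nonzero \<open>u1\<close>, \<open>u2\<close>, \<open>u3\<close> the right-hand side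
  is the expression of \<open>cos_gram_eq_0\<close> at the cosines \<open>n1 / (16 * u1)\<close> and
  so on, times \<open>2048 * (u1 * u2 * u3)\<^sup>2\<close>. The choice 2048 = 16^3 / 2 gives the
  triple product coefficient 1.\<close>

lemma F_elimination:
  fixes x y z :: real
  defines "u1 \<equiv> 1 + 3 * y * z" and "u2 \<equiv> 1 + 3 * z * x" and "u3 \<equiv> 1 + 3 * x * y"
  defines "n1 \<equiv> 9 * (1 + y\<^sup>2) * (1 + z\<^sup>2) - 16 - 4 * u1\<^sup>2"
    and "n2 \<equiv> 9 * (1 + z\<^sup>2) * (1 + x\<^sup>2) - 16 - 4 * u2\<^sup>2"
    and "n3 \<equiv> 9 * (1 + x\<^sup>2) * (1 + y\<^sup>2) - 16 - 4 * u3\<^sup>2"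
  assumes p: "p = x + y + z" and q: "q = y * z + z * x + x * y" and r: "r = x * y * z"
  shows "- 243 * F p q r = 2048 * (u1 * u2 * u3)\<^sup>2
    - 8 * ((n1 * u2 * u3)\<^sup>2 + (u1 * n2 * u3)\<^sup>2 + (u1 * u2 * n3)\<^sup>2) + n1 * n2 * n3 * (u1 * u2 * u3)"
proof -
  \<comment> \<open>The right-hand side has degree 18 in \<open>x\<close>, \<open>y\<close>, \<open>z\<close>. The symmetric functions \<open>U\<close>, \<open>A\<close>, \<open>B\<close>, \<open>C\<close>
    generate it but have degree at most 12, so their expansions in \<open>p\<close>, \<open>q\<close>, \<open>r\<close> stay small.\<close>
  define U where "U = u1 * u2 * u3"
  define A where "A = n1 * u2 * u3 + u1 * n2 * u3 + u1 * u2 * n3"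
  define B where "B = n1 * n2 * u3 + n1 * u2 * n3 + u1 * n2 * n3"
  define C where "C = n1 * n2 * n3"
  note defs = u1_def u2_def u3_def n1_def n2_def n3_def p q r
  have U: "U = 1 + 27*r^2 + 3*q + 9*p*r"
    unfolding U_def defs by algebra
  have A: "A = - 33 - 648*r^2 - 126*q - 243*q*r^2 - 81*q^2 - 162*p*r + 18*p^2 + 27*p^2*q"
    unfolding A_def defs by algebra
  have B: "B = 363 + 4455*r^2 + 1683*q + 1701*q*r^2 + 2025*q^2 + 729*q^3 + 297*p*r
      + 2187*p*r^3 - 1944*p*q*r - 729*p*q^2*r - 396*p^2 + 2187*p^2*r^2 - 837*p^2*q
      - 243*p^2*q^2 + 729*p^3*r + 81*p^4"
    unfolding B_def defs by algebra
  have C: "C = - 1331 - 6534*r^2 - 19683*r^4 - 7260*q + 10692*q*r^2 - 12474*q^2 + 13122*q^2*r^2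
      - 8748*q^3 - 2187*q^4 + 4356*p*r - 43740*p*r^3 + 21384*p*q*r + 14580*p*q^2*r + 2178*p^2
      - 30618*p^2*r^2 + 5940*p^2*q + 3402*p^2*q^2 - 8748*p^3*r - 891*p^4"
    unfolding C_def defs by algebra
  \<comment> \<open>The pairwise products of the three summands of \<open>A\<close> add up to
    \<open>U * B\<close>.\<close>
  have "(n1 * u2 * u3)\<^sup>2 + (u1 * n2 * u3)\<^sup>2 + (u1 * u2 * n3)\<^sup>2 = A\<^sup>2 - 2 * U * B"
    unfolding A_def B_def U_def by algebra
  moreover have "- 243 * F p q r = 2048 * U\<^sup>2 - 8 * (A\<^sup>2 - 2 * U * B) + C * U"
    unfolding F_def U A B C by algebra
  ultimately show ?thesis
    by (simp add: U_def C_def)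
qed

theorem theorem7p3:
  fixes \<sigma> \<tau> \<upsilon> \<phi> \<psi> chi x y z p q r :: real
  assumes "\<sigma> \<in> {-pi<..pi}" and "\<tau> \<in> {-pi<..pi}" and "\<upsilon> \<in> {-pi<..pi}"
    and "\<phi> \<in> {-(pi/2)<..<pi/2}" and "\<psi> \<in> {-(pi/2)<..<pi/2}" and "chi \<in> {-(pi/2)<..<pi/2}"
    and "cp2_dist (zpt \<sigma> \<phi>) (zpt \<tau> \<psi>) = 2 * pi / 3"
    and "cp2_dist (zpt \<tau> \<psi>) (zpt \<upsilon> chi) = 2 * pi / 3"
    and "cp2_dist (zpt \<upsilon> chi) (zpt \<sigma> \<phi>) = 2 * pi / 3"
    and "\<And>P Q. P \<in> {zpt \<sigma> \<phi>, zpt \<tau> \<psi>, zpt \<upsilon> chi} \<Longrightarrow>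
           Q \<in> {proj (vector [0, 1, - omega]), proj (vector [0, 1, - (omega^2)])} \<Longrightarrow>
           cp2_dist P Q = 2 * pi / 3"
    and "x = tan \<phi>" and "y = tan \<psi>" and "z = tan chi"
    and "p = x + y + z" and "q = y * z + z * x + x * y" and "r = x * y * z"
  shows "F p q r = 0"
proof -
  \<comment> \<open>The differences are taken cyclically, so that they sum to zero.\<close>
  define a b c where "a = cos (\<upsilon> - \<tau>)" and "b = cos (\<sigma> - \<upsilon>)" and "c = cos (\<tau> - \<sigma>)"
  define u1 u2 u3 where "u1 = 1 + 3 * y * z" and "u2 = 1 + 3 * z * x" and "u3 = 1 + 3 * x * y"
  have cos: "cos \<phi> \<noteq> 0" "cos \<psi> \<noteq> 0" "cos chi \<noteq> 0"
    using assms(4-6) cos_gt_zero_pi [of \<phi>] cos_gt_zero_pi [of \<psi>] cos_gt_zero_pi [of chi] by auto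
  have n: "9 * (1 + y\<^sup>2) * (1 + z\<^sup>2) - 16 - 4 * u1\<^sup>2 = 16 * u1 * a"
    "9 * (1 + z\<^sup>2) * (1 + x\<^sup>2) - 16 - 4 * u2\<^sup>2 = 16 * u2 * b"
    "9 * (1 + x\<^sup>2) * (1 + y\<^sup>2) - 16 - 4 * u3\<^sup>2 = 16 * u3 * c"
    using cos_phase_difference [OF assms(8)] cos_phase_difference [OF assms(9)]
      cos_phase_difference [OF assms(7)] cos
    by (simp_all add: a_def b_def c_def u1_def u2_def u3_def assms(11-13))
  have "- 243 * F p q r = 2048 * (u1 * u2 * u3)\<^sup>2
    - 8 * ((16 * u1 * a * u2 * u3)\<^sup>2 + (u1 * (16 * u2 * b) * u3)\<^sup>2 + (u1 * u2 * (16 * u3 * c))\<^sup>2)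
    + 16 * u1 * a * (16 * u2 * b) * (16 * u3 * c) * (u1 * u2 * u3)"
    using F_elimination [OF assms(14-16)] unfolding u1_def [symmetric] u2_def [symmetric]
      u3_def [symmetric] n .
  \<comment> \<open>After the substitution every term contains
    \<open>(u1 * u2 * u3)\<^sup>2\<close>, which leaves the Gram expression as cofactor.\<close>
  also have "\<dots> = 2048 * (u1 * u2 * u3)\<^sup>2 * (1 - a\<^sup>2 - b\<^sup>2 - c\<^sup>2 + 2 * a * b * c)"
    by algebra
  also have "\<dots> = 0"
    using cos_gram_eq_0 [of "\<upsilon> - \<tau>" "\<sigma> - \<upsilon>" "\<tau> - \<sigma>"] by (simp add: a_def b_def c_def)
  finally show ?thesis
    by simp
qed

end
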